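(* Let $\pi$ be a commutative semigroup and let $(\{A_\varphi\}_{\varphi\in\pi},\{\star_{p,q}\}_{p,q\in\pi})$ be a Zinbiel T-algebra. Define $$a\prec_{p,q}b=b\star_{q,p}a,\qquad a\succ_{p,q}b=a\star_{p,q}b$$ for $a\in A_p$, $b\in A_q$ and $p,q\in\pi$. Then $(\{A_\varphi\}_{\varphi\in\pi},\{\prec_{p,q}\}_{p,q\in\pi},\{\succ_{p,q}\}_{p,q\in\pi})$ is a dendriform T-algebra.
   Context: $K$ is a field; all vector spaces, tensor products and linear maps are over $K$. For a commutative semigroup $\pi$, a Zinbiel T-algebra is a family of vector spaces $\{A_\varphi\}_{\varphi\in\pi}$ with bilinear operations $\star_{p,q}:A_p\otimes A_q\to A_{pq}$ such that $a\star_{p,qt}(b\star_{q,t}c)=(a\star_{p,q}b)\star_{pq,t}c+(b\star_{q,p}a)\star_{qp,t}c$ for all $p,q,t\in\pi$, $a\in A_p,b\in A_q,c\in A_t$. A dendriform T-algebra (for a semigroup $\pi$) is a family of vector spaces $\{A_\varphi\}_{\varphi\in\pi}$ with bilinear operations (linear maps) $\prec_{p,q},\succ_{p,q}:A_p\otimes A_q\to A_{pq}$ such that for all $p,q,t\in\pi$, $a\in A_p,b\in A_q,c\in A_t$: $(a\prec_{p,q}b)\prec_{pq,t}c=a\prec_{p,qt}(b\prec_{q,t}c+b\succ_{q,t}c)$; $(a\succ_{p,q}b)\prec_{pq,t}c=a\succ_{p,qt}(b\prec_{q,t}c)$; $(a\prec_{p,q}b+a\succ_{p,q}b)\succ_{pq,t}c=a\succ_{p,qt}(b\succ_{q,t}c)$.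 *)

theory Defs
  imports "HOL-Algebra.Module"
begin

text \<open>
  A linear map \<open>U \<otimes> V \<rightarrow> W\<close> is given as the corresponding bilinear map on \<open>U \<times> V\<close>.
  Nothing is assumed about the values of \<open>f\<close> outside the carriers.
\<close>
locale bilinear_map =
  U?: Module.module K U + V?: Module.module K V + W?: Module.module K W
  for K :: "('k, 'n) ring_scheme"
    and U :: "('k, 'u, 'm1) module_scheme"
    and V :: "('k, 'v, 'm2) module_scheme"
    and W :: "('k, 'w, 'm3) module_scheme" +
  fixes f :: "'u \<Rightarrow> 'v \<Rightarrow> 'w"
  assumes map_closed:
      "\<lbrakk>x \<in> carrier U; y \<in> carrier V\<rbrakk> \<Longrightarrow> f x y \<in> carrier W"
    and map_add_left:
      "\<lbrakk>x \<in> carrier U; x' \<in> carrier U; y \<in> carrier V\<rbrakk> \<Longrightarrow>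
        f (x \<oplus>\<^bsub>U\<^esub> x') y = f x y \<oplus>\<^bsub>W\<^esub> f x' y"
    and map_add_right:
      "\<lbrakk>x \<in> carrier U; y \<in> carrier V; y' \<in> carrier V\<rbrakk> \<Longrightarrow>
        f x (y \<oplus>\<^bsub>V\<^esub> y') = f x y \<oplus>\<^bsub>W\<^esub> f x y'"
    and map_smult_left:
      "\<lbrakk>k \<in> carrier K; x \<in> carrier U; y \<in> carrier V\<rbrakk> \<Longrightarrow>
        f (k \<odot>\<^bsub>U\<^esub> x) y = k \<odot>\<^bsub>W\<^esub> f x y"
    and map_smult_right:
      "\<lbrakk>k \<in> carrier K; x \<in> carrier U; y \<in> carrier V\<rbrakk> \<Longrightarrow>
        f x (k \<odot>\<^bsub>V\<^esub> y) = k \<odot>\<^bsub>W\<^esub> f x y"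

text \<open>
  The semigroup \<open>\<pi>\<close> is the index type \<open>'p\<close>.  The vector spaces \<open>A p\<close> are arbitrary: each has
  its own carrier, zero, addition and scalar multiplication.  The element type \<open>'v\<close> is only a
  common container for the carriers, which may overlap.
\<close>
locale vector_space_family = Ring.field K
  for K :: "('k, 'n) ring_scheme" +
  fixes A :: "'p \<Rightarrow> ('k, 'v, 'm) module_scheme"
  assumes vector_space: "\<And>p. Module.module K (A p)"

locale zinbiel_T_algebra = vector_space_family K A
  for K :: "('k, 'n) ring_scheme"
    and A :: "'p::ab_semigroup_mult \<Rightarrow> ('k, 'v, 'm) module_scheme" +
  fixes star :: "'p \<Rightarrow> 'p \<Rightarrow> 'v \<Rightarrow> 'v \<Rightarrow> 'v"
  assumes star_bilinear:
      "\<And>p q. bilinear_map K (A p) (A q) (A (p * q)) (star p q)"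
    and zinbiel:
      "\<And>p q t a b c. \<lbrakk>a \<in> carrier (A p); b \<in> carrier (A q); c \<in> carrier (A t)\<rbrakk> \<Longrightarrow>
        star p (q * t) a (star q t b c) =
          star (p * q) t (star p q a b) c \<oplus>\<^bsub>A (p * q * t)\<^esub> star (q * p) t (star q p b a) c"

locale dendriform_T_algebra = vector_space_family K A
  for K :: "('k, 'n) ring_scheme"
    and A :: "'p::semigroup_mult \<Rightarrow> ('k, 'v, 'm) module_scheme" +
  fixes lprec rsucc :: "'p \<Rightarrow> 'p \<Rightarrow> 'v \<Rightarrow> 'v \<Rightarrow> 'v"
  assumes lprec_bilinear:
      "\<And>p q. bilinear_map K (A p) (A q) (A (p * q)) (lprec p q)"
    and rsucc_bilinear:
      "\<And>p q. bilinear_map K (A p) (A q) (A (p * q)) (rsucc p q)"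
    and lprec_lprec:
      "\<And>p q t a b c. \<lbrakk>a \<in> carrier (A p); b \<in> carrier (A q); c \<in> carrier (A t)\<rbrakk> \<Longrightarrow>
        lprec (p * q) t (lprec p q a b) c =
          lprec p (q * t) a (lprec q t b c \<oplus>\<^bsub>A (q * t)\<^esub> rsucc q t b c)"
    and rsucc_lprec:
      "\<And>p q t a b c. \<lbrakk>a \<in> carrier (A p); b \<in> carrier (A q); c \<in> carrier (A t)\<rbrakk> \<Longrightarrow>
        lprec (p * q) t (rsucc p q a b) c = rsucc p (q * t) a (lprec q t b c)"
    and rsucc_rsucc:
      "\<And>p q t a b c. \<lbrakk>a \<in> carrier (A p); b \<in> carrier (A q); c \<in> carrier (A t)\<rbrakk> \<Longrightarrow>
        rsucc (p * q) t (lprec p q a b \<oplus>\<^bsub>A (p * q)\<^esub> rsucc p q a b) c =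
          rsucc p (q * t) a (rsucc q t b c)"

end

theory Submission
  imports Defs
begin

text \<open>Write a o b for the symmetrized product a * b + b * a, which makes sense because
  commutativity of the semigroup puts both terms in the same space. Additivity turns the Zinbiel
  identity into (a o b) * c = a * (b * c) (\<open>star_symmetrized_star\<close>). This gives the two
  dendriform axioms containing a sum, one of them with the letters reversed. The remaining axiom is
  a * (c * b) = c * (a * b), which holds because a o c = c o a
  (\<open>star_left_commute\<close>).\<close>

lemma (in bilinear_map) bilinear_map_flip: "bilinear_map K V U W (\<lambda>y x. f x y)"
  by unfold_locales
    (simp_all add: map_closed map_add_left map_add_right map_smult_left map_smult_right)

context zinbiel_T_algebra
begin

lemma star_closed:
  assumes "a \<in> carrier (A p)" "b \<in> carrier (A q)"
  shows "star p q a b \<in> carrier (A (p * q))"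
  using bilinear_map.map_closed[OF star_bilinear assms] .

lemma star_add_left:
  assumes "a \<in> carrier (A p)" "a' \<in> carrier (A p)" "b \<in> carrier (A q)"
  shows "star p q (a \<oplus>\<^bsub>A p\<^esub> a') b = star p q a b \<oplus>\<^bsub>A (p * q)\<^esub> star p q a' b"
  using bilinear_map.map_add_left[OF star_bilinear assms] .

lemma star_symmetrized_star:
  assumes a: "a \<in> carrier (A p)" and b: "b \<in> carrier (A q)" and c: "c \<in> carrier (A t)"
  shows "star (p * q) t (star p q a b \<oplus>\<^bsub>A (p * q)\<^esub> star q p b a) c = star p (q * t) a (star q t b c)"
proof -
  \<comment> \<open>The product lies a priori over \<open>q * p\<close>; left additivity needs both
    summands over \<open>p * q\<close>.\<close>
  have "star q p b a \<in> carrier (A (p * q))"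
    using star_closed[OF b a] by (simp add: mult.commute)
  then have "star (p * q) t (star p q a b \<oplus>\<^bsub>A (p * q)\<^esub> star q p b a) c =
      star (p * q) t (star p q a b) c \<oplus>\<^bsub>A (p * q * t)\<^esub> star (p * q) t (star q p b a) c"
    by (intro star_add_left star_closed a b c)
  also have "\<dots> = star p (q * t) a (star q t b c)"
    by (simp add: zinbiel[OF a b c] mult.commute[of q p])
  finally show ?thesis .
qed

lemma star_add_commute:
  assumes a: "a \<in> carrier (A p)" and b: "b \<in> carrier (A q)"
  shows "star p q a b \<oplus>\<^bsub>A (p * q)\<^esub> star q p b a = star q p b a \<oplus>\<^bsub>A (q * p)\<^esub> star p q a b"
proof -
  interpret M: Module.module K "A (p * q)" by (rule vector_space)
  have "star q p b a \<in> carrier (A (p * q))"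
    using star_closed[OF b a] by (simp add: mult.commute)
  then show ?thesis
    by (simp add: M.a_comm star_closed a b mult.commute[of q p])
qed

text \<open>Each side is a symmetrized product of \<open>a\<close> and \<open>b\<close> acting on
  \<open>c\<close>, and that product ignores their order.\<close>

lemma star_left_commute:
  assumes a: "a \<in> carrier (A p)" and b: "b \<in> carrier (A q)" and c: "c \<in> carrier (A t)"
  shows "star p (q * t) a (star q t b c) = star q (p * t) b (star p t a c)"
  unfolding star_symmetrized_star[OF a b c, symmetric] star_symmetrized_star[OF b a c, symmetric]
  by (simp only: star_add_commute[OF a b] mult.commute[of q p])

end

theorem proposition4p18:
  fixes K :: "('k, 'n) ring_scheme"
    and A :: "'p::ab_semigroup_mult \<Rightarrow> ('k, 'v, 'm) module_scheme"
    and star :: "'p \<Rightarrow> 'p \<Rightarrow> 'v \<Rightarrow> 'v \<Rightarrow> 'v"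
  assumes "zinbiel_T_algebra K A star"
  shows "dendriform_T_algebra K A (\<lambda>p q a b. star q p b a) (\<lambda>p q a b. star p q a b)"
proof -
  interpret zinbiel_T_algebra K A star by fact
  show ?thesis
  proof (intro dendriform_T_algebra.intro dendriform_T_algebra_axioms.intro)
    show "vector_space_family K A" ..
  next
    fix p q :: 'p
    show "bilinear_map K (A p) (A q) (A (p * q)) (\<lambda>a b. star q p b a)"
      \<comment> \<open>The flipped map has target \<open>A (q * p)\<close>, which is
        \<open>A (p * q)\<close> by commutativity.\<close>
      using bilinear_map.bilinear_map_flip[OF star_bilinear[of q p]] by (simp add: mult.commute)
    show "bilinear_map K (A p) (A q) (A (p * q)) (\<lambda>a b. star p q a b)"
      by (rule star_bilinear)
  next
    fix p q t :: 'p and a b c :: 'v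
    assume a: "a \<in> carrier (A p)" and b: "b \<in> carrier (A q)" and c: "c \<in> carrier (A t)"
    show "star t (p * q) c (star q p b a) =
        star (q * t) p (star t q c b \<oplus>\<^bsub>A (q * t)\<^esub> star q t b c) a"
      \<comment> \<open>The left product swaps its arguments, so the axiom reads backwards as c * (b
        * a) = (c o b) * a.\<close>
      using star_symmetrized_star[OF c b a] by (simp add: mult.commute)
    show "star t (p * q) c (star p q a b) = star p (q * t) a (star t q c b)"
      using star_left_commute[OF c a b] by (simp add: mult.commute)
    show "star (p * q) t (star q p b a \<oplus>\<^bsub>A (p * q)\<^esub> star p q a b) c =
        star p (q * t) a (star q t b c)"
      using star_symmetrized_star[OF a b c] star_add_commute[OF a b]
      by (simp add: mult.commute)
  qed
qed

end
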